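(* Let $(M,g)$ be a two-dimensional oriented Riemannian manifold with curvature $K$. Let $\gamma:(a,b)\to M$ be a solution of $$\nabla_{\frac{d\gamma}{dt}}\frac{d\gamma}{dt}=C\,K\,J(\dot\gamma)-C^2K\,\mathrm{grad}\,K$$ with constant $C\neq0$, and let $t_0\in(a,b)$. Then $\gamma(t)$ lies in the region $$\Omega=\left\{p\in M\ \Big|\ |K(p)|\le\sqrt{\frac{1}{C}\left\|\frac{d\gamma}{dt}(t_0)\right\|+K^2(\gamma(t_0))}\right\}.$$ If, in addition, $(M,g)$ is a surface of revolution, then $\Omega$ is a band consisting of parallels of $M$.
   Context: $\nabla$ is the Levi-Civita connection of $g$, $\|\cdot\|$ the norm of $g$, and $J$ the operator of the complex structure associated with $g$ and the orientation (for a positively oriented orthonormal frame, $Je_1=e_2$, $Je_2=-e_1$). A surface of revolution is described by coordinates $(u^1,u^2)$, $u^1$ being the rotation angle, with $g=A^2(u^2)\,du^1\otimes du^1+du^2\otimes du^2$; its parallels are the curves $u^2=\mathrm{const}$.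
   Formalization: The printed radius is false (e.g. unit sphere, C=-1, speed 1/2 at t=t_0); it is corrected to sqrt((1/C^2)||dγ/dt(t_0)||^2+K^2(γ(t_0))). A band is a union of parallels over a nonempty closed set of u^2-values, possibly with several components. *)

theory Defs
  imports "HOL-Analysis.Analysis"
begin

definition partial_deriv :: "2 \<Rightarrow> (real^2 \<Rightarrow> 'b::real_normed_vector) \<Rightarrow> real^2 \<Rightarrow> 'b" where
  "partial_deriv i f x = frechet_derivative f (at x) (axis i 1)"

fun Ck_on :: "nat \<Rightarrow> (real^2) set \<Rightarrow> (real^2 \<Rightarrow> 'b::real_normed_vector) \<Rightarrow> bool" where
  "Ck_on 0 S f \<longleftrightarrow> continuous_on S f"
| "Ck_on (Suc k) S f \<longleftrightarrow> f differentiable_on S \<and> (\<forall>i. Ck_on k S (partial_deriv i f))"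

definition smooth_on :: "(real^2) set \<Rightarrow> (real^2 \<Rightarrow> 'b::real_normed_vector) \<Rightarrow> bool" where
  "smooth_on S f \<longleftrightarrow> open S \<and> (\<forall>k. Ck_on k S f)"

text \<open>A chart is a pair of a domain and a coordinate map; the values of the coordinate map
  outside the domain are irrelevant.\<close>

type_synonym 'a chart = "'a set \<times> ('a \<Rightarrow> real^2)"

abbreviation cdom :: "'a chart \<Rightarrow> 'a set" where "cdom c \<equiv> fst c"

abbreviation coord :: "'a chart \<Rightarrow> 'a \<Rightarrow> real^2" where "coord c \<equiv> snd c"

abbreviation cinv :: "'a chart \<Rightarrow> real^2 \<Rightarrow> 'a" where "cinv c \<equiv> inv_into (cdom c) (coord c)"

definition topological_chart :: "'a topology \<Rightarrow> 'a chart \<Rightarrow> bool" where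
  "topological_chart T c \<longleftrightarrow>
     openin T (cdom c) \<and> open (coord c ` cdom c) \<and>
     homeomorphic_map (subtopology T (cdom c)) (top_of_set (coord c ` cdom c)) (coord c)"

definition transition :: "'a chart \<Rightarrow> 'a chart \<Rightarrow> real^2 \<Rightarrow> real^2" where
  "transition c d = coord d \<circ> cinv c"

definition oriented_transition :: "'a chart \<Rightarrow> 'a chart \<Rightarrow> bool" where
  "oriented_transition c d \<longleftrightarrow>
     smooth_on (coord c ` (cdom c \<inter> cdom d)) (transition c d) \<and>
     (\<forall>x \<in> coord c ` (cdom c \<inter> cdom d). det (jacobian (transition c d) (at x)) > 0)"

text \<open>The metric is given by its component matrix in each chart, as a function of the
  coordinates.\<close>

record 'a surface =
  stop :: "'a topology"
  charts :: "'a chart set"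
  metric :: "'a chart \<Rightarrow> real^2 \<Rightarrow> real^2^2"

text \<open>The set of charts is the full (maximal) oriented smooth structure.\<close>

definition oriented_smooth_surface :: "'a surface \<Rightarrow> bool" where
  "oriented_smooth_surface M \<longleftrightarrow>
     Hausdorff_space (stop M) \<and> second_countable (stop M) \<and>
     (\<forall>c \<in> charts M. topological_chart (stop M) c) \<and>
     (\<Union>c \<in> charts M. cdom c) = topspace (stop M) \<and>
     (\<forall>c \<in> charts M. \<forall>d \<in> charts M. oriented_transition c d) \<and>
     (\<forall>c. topological_chart (stop M) c \<and>
          (\<forall>d \<in> charts M. oriented_transition c d \<and> oriented_transition d c) \<longrightarrow> c \<in> charts M)"

definition riemannian_metric :: "'a surface \<Rightarrow> bool" where
  "riemannian_metric M \<longleftrightarrow>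
     (\<forall>c \<in> charts M. smooth_on (coord c ` cdom c) (metric M c) \<and>
        (\<forall>x \<in> coord c ` cdom c.
           transpose (metric M c x) = metric M c x \<and>
           (\<forall>v. v \<noteq> 0 \<longrightarrow> v \<bullet> (metric M c x *v v) > 0))) \<and>
     (\<forall>c \<in> charts M. \<forall>d \<in> charts M. \<forall>p \<in> cdom c \<inter> cdom d.
        let D = jacobian (transition c d) (at (coord c p))
        in metric M c (coord c p) = transpose D ** metric M d (coord d p) ** D)"

definition oriented_riemannian_surface :: "'a surface \<Rightarrow> bool" where
  "oriented_riemannian_surface M \<longleftrightarrow> oriented_smooth_surface M \<and> riemannian_metric M"

definition christoffel :: "(real^2 \<Rightarrow> real^2^2) \<Rightarrow> 2 \<Rightarrow> 2 \<Rightarrow> 2 \<Rightarrow> real^2 \<Rightarrow> real" where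
  "christoffel G k i j x =
     (\<Sum>l\<in>UNIV. matrix_inv (G x) $ k $ l *
        (partial_deriv i G x $ j $ l + partial_deriv j G x $ i $ l - partial_deriv l G x $ i $ j)) / 2"

text \<open>The \<open>l\<close>-th component of \<open>R(\<partial>\<^sub>i, \<partial>\<^sub>j) \<partial>\<^sub>k\<close>, where
  \<open>R(X, Y) Z = \<nabla>\<^sub>X \<nabla>\<^sub>Y Z - \<nabla>\<^sub>Y \<nabla>\<^sub>X Z - \<nabla>\<^bsub>[X, Y]\<^esub> Z\<close>.\<close>

definition riemann :: "(real^2 \<Rightarrow> real^2^2) \<Rightarrow> 2 \<Rightarrow> 2 \<Rightarrow> 2 \<Rightarrow> 2 \<Rightarrow> real^2 \<Rightarrow> real" where
  "riemann G l i j k x =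
     partial_deriv i (christoffel G l j k) x - partial_deriv j (christoffel G l i k) x +
     (\<Sum>m\<in>UNIV. christoffel G m j k x * christoffel G l i m x
               - christoffel G m i k x * christoffel G l j m x)"

text \<open>\<open>g(R(\<partial>\<^sub>1, \<partial>\<^sub>2) \<partial>\<^sub>2, \<partial>\<^sub>1) / (g\<^sub>1\<^sub>1 g\<^sub>2\<^sub>2 - g\<^sub>1\<^sub>2\<^sup>2)\<close>; positive on the round sphere.\<close>

definition coord_curvature :: "(real^2 \<Rightarrow> real^2^2) \<Rightarrow> real^2 \<Rightarrow> real" where
  "coord_curvature G x = (\<Sum>l\<in>UNIV. G x $ 1 $ l * riemann G l 1 2 2 x) / det (G x)"

text \<open>The curvature of the surface is the function on it whose value at a point is computed by the
  formula above in any chart around the point. Such a function exists by the Theorema Egregium,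
  and it is unique on the surface because the charts cover it.\<close>

definition is_curvature :: "'a surface \<Rightarrow> ('a \<Rightarrow> real) \<Rightarrow> bool" where
  "is_curvature M K \<longleftrightarrow>
     (\<forall>c \<in> charts M. \<forall>p \<in> cdom c. K p = coord_curvature (metric M c) (coord c p))"

text \<open>A vector at a point is given by its components with respect to a chart around the point.\<close>

definition grad :: "'a surface \<Rightarrow> 'a chart \<Rightarrow> ('a \<Rightarrow> real) \<Rightarrow> 'a \<Rightarrow> real^2" where
  "grad M c f p =
     matrix_inv (metric M c (coord c p)) *v (\<chi> j. partial_deriv j (f \<circ> cinv c) (coord c p))"

definition positive_orthonormal :: "real^2^2 \<Rightarrow> real^2 \<Rightarrow> real^2 \<Rightarrow> bool" where
  "positive_orthonormal G e1 e2 \<longleftrightarrow>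
     e1 \<bullet> (G *v e1) = 1 \<and> e2 \<bullet> (G *v e2) = 1 \<and> e1 \<bullet> (G *v e2) = 0 \<and>
     det (vector [e1, e2] :: real^2^2) > 0"

definition complex_structure :: "real^2^2 \<Rightarrow> real^2 \<Rightarrow> real^2" where
  "complex_structure G = (THE L. linear L \<and>
     (\<forall>e1 e2. positive_orthonormal G e1 e2 \<longrightarrow> L e1 = e2 \<and> L e2 = - e1))"

definition velocity :: "'a chart \<Rightarrow> (real \<Rightarrow> 'a) \<Rightarrow> real \<Rightarrow> real^2" where
  "velocity c \<gamma> t = vector_derivative (coord c \<circ> \<gamma>) (at t)"

definition covariant_acceleration :: "'a surface \<Rightarrow> 'a chart \<Rightarrow> (real \<Rightarrow> 'a) \<Rightarrow> real \<Rightarrow> real^2" where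
  "covariant_acceleration M c \<gamma> t =
     vector_derivative (velocity c \<gamma>) (at t) +
     (\<chi> k. \<Sum>i\<in>UNIV. \<Sum>j\<in>UNIV. christoffel (metric M c) k i j (coord c (\<gamma> t)) *
            velocity c \<gamma> t $ i * velocity c \<gamma> t $ j)"

text \<open>The norm of the velocity vector does not depend on the chart.\<close>

definition speed :: "'a surface \<Rightarrow> (real \<Rightarrow> 'a) \<Rightarrow> real \<Rightarrow> real" where
  "speed M \<gamma> t =
     (let c = (SOME c. c \<in> charts M \<and> \<gamma> t \<in> cdom c); v = velocity c \<gamma> t
      in sqrt (v \<bullet> (metric M c (coord c (\<gamma> t)) *v v)))"

text \<open>A curve is twice differentiable if it is so in all charts; the equation is an equality of
  tangent vectors, that is, of components in all charts.\<close>

definition twice_differentiable_curve :: "'a surface \<Rightarrow> real set \<Rightarrow> (real \<Rightarrow> 'a) \<Rightarrow> bool" where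
  "twice_differentiable_curve M T \<gamma> \<longleftrightarrow>
     continuous_map (top_of_set T) (stop M) \<gamma> \<and>
     (\<forall>t \<in> T. \<forall>c \<in> charts M. \<gamma> t \<in> cdom c \<longrightarrow>
        (coord c \<circ> \<gamma>) differentiable (at t) \<and> velocity c \<gamma> differentiable (at t))"

definition solution_curve ::
  "'a surface \<Rightarrow> ('a \<Rightarrow> real) \<Rightarrow> real \<Rightarrow> real set \<Rightarrow> (real \<Rightarrow> 'a) \<Rightarrow> bool" where
  "solution_curve M K C T \<gamma> \<longleftrightarrow>
     twice_differentiable_curve M T \<gamma> \<and>
     (\<forall>t \<in> T. \<forall>c \<in> charts M. \<gamma> t \<in> cdom c \<longrightarrow>
        covariant_acceleration M c \<gamma> t =
          (C * K (\<gamma> t)) *\<^sub>R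
             complex_structure (metric M c (coord c (\<gamma> t))) (velocity c \<gamma> t)
          - (C\<^sup>2 * K (\<gamma> t)) *\<^sub>R grad M c K (\<gamma> t))"

text \<open>\<open>X\<close> maps the coordinates \<open>(u\<^sup>1, u\<^sup>2)\<close>, with \<open>u\<^sup>1\<close> real and \<open>u\<^sup>2\<close> in the open interval \<open>I\<close>, to
  points. It is locally the inverse of a chart in which the metric is
  \<open>A\<^sup>2(u\<^sup>2) du\<^sup>1 \<otimes> du\<^sup>1 + du\<^sup>2 \<otimes> du\<^sup>2\<close> (so \<open>A\<close> is smooth). Shifting \<open>u\<^sup>1\<close> is a well-defined rotation of
  the surface, and it fixes a point only if the shift is a multiple of \<open>2\<pi>\<close>. The coordinate
  \<open>u\<^sup>2\<close> is not required to be injective on meridians, so tori of revolution are included.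
  That the coordinates are positively oriented is no restriction: replace \<open>u\<^sup>1\<close> by \<open>- u\<^sup>1\<close>.\<close>

definition surface_of_revolution ::
  "'a surface \<Rightarrow> (real^2 \<Rightarrow> 'a) \<Rightarrow> real set \<Rightarrow> (real \<Rightarrow> real) \<Rightarrow> bool" where
  "surface_of_revolution M X I A \<longleftrightarrow>
     open I \<and> is_interval I \<and> I \<noteq> {} \<and> (\<forall>r \<in> I. A r > 0) \<and>
     X ` {u. u $ 2 \<in> I} = topspace (stop M) \<and>
     (\<forall>u u'. u $ 2 \<in> I \<and> u' $ 2 \<in> I \<and> X u = X u' \<longrightarrow>
        (\<forall>s. X (u + axis 1 s) = X (u' + axis 1 s))) \<and>
     (\<forall>u s. u $ 2 \<in> I \<longrightarrow> (X (u + axis 1 s) = X u \<longleftrightarrow> (\<exists>n::int. s = 2 * pi * of_int n))) \<and>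
     (\<forall>u. u $ 2 \<in> I \<longrightarrow>
        (\<exists>W. open W \<and> u \<in> W \<and> (\<forall>w \<in> W. w $ 2 \<in> I) \<and>
           (\<exists>c \<in> charts M. cdom c = X ` W \<and>
              (\<forall>w \<in> W. coord c (X w) = w \<and>
                 metric M c w = vector [vector [(A (w $ 2))\<^sup>2, 0], vector [0, 1]]))))"

definition parallel_curve :: "(real^2 \<Rightarrow> 'a) \<Rightarrow> real \<Rightarrow> 'a set" where
  "parallel_curve X r = X ` {u. u $ 2 = r}"

text \<open>A band is the union of the parallels over a nonempty closed set of values of \<open>u\<^sup>2\<close>, possibly
  with several components.\<close>

definition band_of_parallels :: "(real^2 \<Rightarrow> 'a) \<Rightarrow> real set \<Rightarrow> 'a set \<Rightarrow> bool" where
  "band_of_parallels X I B \<longleftrightarrow>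
     (\<exists>S \<subseteq> I. S \<noteq> {} \<and> closedin (top_of_set I) S \<and> B = (\<Union>r\<in>S. parallel_curve X r))"

end

theory Submission
  imports Defs
begin

text \<open>
  Along a solution the energy \<open>E = \<parallel>\<gamma>'\<parallel>\<^sup>2 + C\<^sup>2 K\<^sup>2\<close> is constant. The connection is metric, so
  \<open>d/dt \<parallel>\<gamma>'\<parallel>\<^sup>2 = 2 g(\<nabla>\<gamma>', \<gamma>') = 2 C K g(J\<gamma>', \<gamma>') - 2 C\<^sup>2 K dK(\<gamma>')\<close>; here \<open>g(J\<gamma>', \<gamma>') = 0\<close>, and the
  last term is \<open>- d/dt (C\<^sup>2 K\<^sup>2)\<close>. Hence \<open>C\<^sup>2 K(\<gamma>(t))\<^sup>2 \<le> E\<close> for all \<open>t\<close>, which is the stated bound. On a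
  surface of revolution \<open>K\<close> is a continuous function of \<open>u\<^sup>2\<close> alone, so a sublevel set of \<open>\<bar>K\<bar>\<close> is a
  union of parallels over a closed set of values of \<open>u\<^sup>2\<close>.
\<close>

subsection \<open>Partial derivatives and smoothness classes\<close>

text \<open>\<open>frechet_derivative\<close> is a choice among all derivatives. Functions that
  agree near \<open>x\<close> have the same derivatives there, so the choices coincide even where no
  derivative exists.\<close>

lemma frechet_derivative_cong_open:
  assumes "open S" "x \<in> S" "\<And>y. y \<in> S \<Longrightarrow> f y = g y"
  shows "frechet_derivative f (at x) = frechet_derivative g (at x)"
proof -
  have "(f has_derivative D) (at x) \<longleftrightarrow> (g has_derivative D) (at x)" for D
    using has_derivative_transform_within_open[OF _ assms(1,2)] assms(3) by metis
  then show ?thesis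
    by (simp add: frechet_derivative_def)
qed

lemma partial_deriv_cong:
  assumes "open S" "x \<in> S" "\<And>y. y \<in> S \<Longrightarrow> f y = g y"
  shows "partial_deriv i f x = partial_deriv i g x"
  unfolding partial_deriv_def using frechet_derivative_cong_open[OF assms] by simp

lemma partial_deriv_eqI:
  "(f has_derivative D) (at x) \<Longrightarrow> partial_deriv i f x = D (axis i 1)"
  unfolding partial_deriv_def by (simp add: frechet_derivative_at[symmetric])

lemma frechet_derivative_eq_partial:
  assumes "f differentiable at x"
  shows "frechet_derivative f (at x) v = (\<Sum>i\<in>UNIV. v $ i *\<^sub>R partial_deriv i f x)"
proof -
  have lin: "linear (frechet_derivative f (at x))"
    using assms linear_frechet_derivative by blast
  have "v = (\<Sum>i\<in>UNIV. v $ i *\<^sub>R axis i 1)"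
    using basis_expansion[of v] by (simp add: scalar_mult_eq_scaleR)
  then have "frechet_derivative f (at x) v = frechet_derivative f (at x) (\<Sum>i\<in>UNIV. v $ i *\<^sub>R axis i 1)"
    by simp
  also have "\<dots> = (\<Sum>i\<in>UNIV. v $ i *\<^sub>R partial_deriv i f x)"
    by (simp add: linear_sum[OF lin] linear_cmul[OF lin] partial_deriv_def)
  finally show ?thesis .
qed

lemma has_derivative_partial:
  assumes "f differentiable at x"
  shows "(f has_derivative (\<lambda>v. \<Sum>i\<in>UNIV. v $ i *\<^sub>R partial_deriv i f x)) (at x)"
proof -
  have "frechet_derivative f (at x) = (\<lambda>v. \<Sum>i\<in>UNIV. v $ i *\<^sub>R partial_deriv i f x)"
    using frechet_derivative_eq_partial[OF assms] by (rule ext)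
  with assms[unfolded frechet_derivative_works] show ?thesis
    by simp
qed

text \<open>On an open set, agreement on \<open>S\<close> is agreement near each of its points. The
  partial derivatives therefore agree on \<open>S\<close> again, and the induction
  continues.\<close>

lemma Ck_on_cong:
  assumes "open S" "\<And>x. x \<in> S \<Longrightarrow> f x = g x"
  shows "Ck_on k S f \<longleftrightarrow> Ck_on k S g"
  using assms(2)
proof (induction k arbitrary: f g)
  case 0
  then show ?case by (simp cong: continuous_on_cong)
next
  case (Suc k)
  have "f differentiable (at x within S) \<longleftrightarrow> g differentiable (at x within S)" if "x \<in> S" for x
    using differentiable_transform_within[of f x S 1 g] differentiable_transform_within[of g x S 1 f]
      Suc.prems that by auto
  then have "f differentiable_on S \<longleftrightarrow> g differentiable_on S"
    by (simp add: differentiable_on_def)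
  moreover have "Ck_on k S (partial_deriv i f) \<longleftrightarrow> Ck_on k S (partial_deriv i g)" for i
    by (rule Suc.IH) (rule partial_deriv_cong[OF assms(1)], auto simp: Suc.prems)
  ultimately show ?case by simp
qed

text \<open>Lets the closure properties below be read off from any derivative formula, evaluated at
  the axis vectors, without computing \<open>partial_deriv\<close> itself.\<close>

lemma Ck_on_SucI:
  assumes "open S" "\<And>x. x \<in> S \<Longrightarrow> (f has_derivative f' x) (at x)"
    and "\<And>i. Ck_on k S (\<lambda>x. f' x (axis i 1))"
  shows "Ck_on (Suc k) S f"
proof -
  have "f differentiable (at x within S)" if "x \<in> S" for x
    using assms(2)[OF that] differentiableI differentiable_at_withinI by blast
  moreover have "Ck_on k S (partial_deriv i f)" for i
    using assms(3) Ck_on_cong[OF assms(1), of "partial_deriv i f" "\<lambda>x. f' x (axis i 1)" k]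
      partial_deriv_eqI[OF assms(2)] by simp
  ultimately show ?thesis by (simp add: differentiable_on_def)
qed

lemma Ck_on_SucD: "Ck_on (Suc k) S f \<Longrightarrow> Ck_on k S f"
proof (induction k arbitrary: f)
  case 0
  then show ?case by (simp add: differentiable_imp_continuous_on)
next
  case (Suc k)
  from Suc.prems have "f differentiable_on S" "Ck_on (Suc k) S (partial_deriv i f)" for i
    by simp_all
  with Suc.IH show ?case by auto
qed

lemma Ck_on_has_derivative:
  assumes "Ck_on (Suc k) S f" "open S" "x \<in> S"
  shows "(f has_derivative frechet_derivative f (at x)) (at x)"
proof -
  have "f differentiable (at x within S)"
    using assms by (simp add: differentiable_on_def)
  then show ?thesis
    unfolding at_within_open[OF assms(3,2)] frechet_derivative_works .
qed

lemma Ck_on_frechet_derivative: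
  "Ck_on (Suc k) S f \<Longrightarrow> Ck_on k S (\<lambda>x. frechet_derivative f (at x) (axis i 1))"
  by (simp add: partial_deriv_def[abs_def])

section \<open>Closure of the \<open>Ck_on\<close> classes under algebraic operations\<close>

lemma Ck_on_const: "open S \<Longrightarrow> Ck_on k S (\<lambda>x. c)"
proof (induction k arbitrary: c)
  case (Suc k)
  show ?case
    by (rule Ck_on_SucI[OF Suc.prems has_derivative_const Suc.IH[OF Suc.prems]])
qed simp

lemma Ck_on_bounded_linear:
  assumes "bounded_linear L" "open S"
  shows "Ck_on k S f \<Longrightarrow> Ck_on k S (\<lambda>x. L (f x))"
proof (induction k arbitrary: f)
  case 0
  then show ?case using bounded_linear.continuous_on[OF assms(1)] by auto
next
  case (Suc k)
  show ?case
    by (rule Ck_on_SucI[OF assms(2)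
          bounded_linear.has_derivative[OF assms(1) Ck_on_has_derivative[OF Suc.prems assms(2)]]
          Suc.IH[OF Ck_on_frechet_derivative[OF Suc.prems]]])
qed

lemma Ck_on_add:
  assumes "open S"
  shows "Ck_on k S f \<Longrightarrow> Ck_on k S g \<Longrightarrow> Ck_on k S (\<lambda>x. f x + g x)"
proof (induction k arbitrary: f g)
  case 0
  then show ?case by (auto intro: continuous_intros)
next
  case (Suc k)
  note D = Ck_on_has_derivative[OF _ assms] and P = Ck_on_frechet_derivative
  show ?case
    by (rule Ck_on_SucI[OF assms has_derivative_add[OF D[OF Suc.prems(1)] D[OF Suc.prems(2)]]
          Suc.IH[OF P[OF Suc.prems(1)] P[OF Suc.prems(2)]]])
qed

text \<open>The product rule multiplies a derivative, which is only of class \<open>k\<close>, by an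
  undifferentiated factor of class \<open>Suc k\<close>; \<open>Ck_on_SucD\<close> lowers the latter
  so that the induction hypothesis applies.\<close>

lemma Ck_on_mult:
  fixes f g :: "real^2 \<Rightarrow> real"
  assumes "open S"
  shows "Ck_on k S f \<Longrightarrow> Ck_on k S g \<Longrightarrow> Ck_on k S (\<lambda>x. f x * g x)"
proof (induction k arbitrary: f g)
  case 0
  then show ?case by (auto intro: continuous_intros)
next
  case (Suc k)
  note D = Ck_on_has_derivative[OF _ assms] and P = Ck_on_frechet_derivative and low = Ck_on_SucD
  show ?case
    by (rule Ck_on_SucI[OF assms has_derivative_mult[OF D[OF Suc.prems(1)] D[OF Suc.prems(2)]]
          Ck_on_add[OF assms Suc.IH[OF low[OF Suc.prems(1)] P[OF Suc.prems(2)]]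
            Suc.IH[OF P[OF Suc.prems(1)] low[OF Suc.prems(2)]]]])
qed

text \<open>The derivative of \<open>1/f\<close> contains \<open>1/f\<close> itself, which has class
  \<open>k\<close> by the induction hypothesis for the same \<open>f\<close>.\<close>

lemma Ck_on_inverse:
  fixes f :: "real^2 \<Rightarrow> real"
  assumes "open S" "\<And>x. x \<in> S \<Longrightarrow> f x \<noteq> 0"
  shows "Ck_on k S f \<Longrightarrow> Ck_on k S (\<lambda>x. inverse (f x))"
proof (induction k)
  case 0
  then show ?case using assms(2) by (auto intro: continuous_intros)
next
  case (Suc k)
  note inv = Suc.IH[OF Ck_on_SucD[OF Suc.prems]]
  have "((\<lambda>x. inverse (f x)) has_derivative
      (\<lambda>h. - (inverse (f x) * frechet_derivative f (at x) h * inverse (f x)))) (at x)"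
    if "x \<in> S" for x
    by (rule Deriv.has_derivative_inverse[OF assms(2)[OF that]
          Ck_on_has_derivative[OF Suc.prems assms(1) that]])
  moreover have "Ck_on k S (\<lambda>x. - (inverse (f x) * frechet_derivative f (at x) (axis i 1) * inverse (f x)))"
    for i
    by (intro Ck_on_bounded_linear[OF bounded_linear_minus[OF bounded_linear_ident] assms(1)]
        Ck_on_mult[OF assms(1)] inv Ck_on_frechet_derivative[OF Suc.prems])
  ultimately show ?case
    by (rule Ck_on_SucI[OF assms(1)])
qed

section \<open>Closure properties of smooth functions\<close>

lemma smooth_on_cong:
  "open S \<Longrightarrow> (\<And>x. x \<in> S \<Longrightarrow> f x = g x) \<Longrightarrow> smooth_on S f \<longleftrightarrow> smooth_on S g"
  using Ck_on_cong unfolding smooth_on_def by blast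

lemma smooth_on_open: "smooth_on S f \<Longrightarrow> open S"
  by (simp add: smooth_on_def)

lemma smooth_on_const: "open S \<Longrightarrow> smooth_on S (\<lambda>x. c)"
  by (simp add: smooth_on_def Ck_on_const)

lemma smooth_on_bounded_linear:
  "bounded_linear L \<Longrightarrow> smooth_on S f \<Longrightarrow> smooth_on S (\<lambda>x. L (f x))"
  by (simp add: smooth_on_def Ck_on_bounded_linear)

lemma smooth_on_add: "smooth_on S f \<Longrightarrow> smooth_on S g \<Longrightarrow> smooth_on S (\<lambda>x. f x + g x)"
  by (simp add: smooth_on_def Ck_on_add)

lemma smooth_on_diff: "smooth_on S f \<Longrightarrow> smooth_on S g \<Longrightarrow> smooth_on S (\<lambda>x. f x - g x)"
  using smooth_on_add[of S f "\<lambda>x. - g x"]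
    smooth_on_bounded_linear[OF bounded_linear_minus[OF bounded_linear_ident], of S g]
  by simp

lemma smooth_on_mult:
  fixes f g :: "real^2 \<Rightarrow> real"
  shows "smooth_on S f \<Longrightarrow> smooth_on S g \<Longrightarrow> smooth_on S (\<lambda>x. f x * g x)"
  by (simp add: smooth_on_def Ck_on_mult)

lemma smooth_on_divide:
  fixes f g :: "real^2 \<Rightarrow> real"
  shows "smooth_on S f \<Longrightarrow> smooth_on S g \<Longrightarrow> (\<And>x. x \<in> S \<Longrightarrow> g x \<noteq> 0) \<Longrightarrow>
    smooth_on S (\<lambda>x. f x / g x)"
  by (simp add: smooth_on_def Ck_on_mult Ck_on_inverse divide_inverse)

lemma smooth_on_sum:
  assumes "open S" "\<And>i. i \<in> I \<Longrightarrow> smooth_on S (f i)"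
  shows "smooth_on S (\<lambda>x. \<Sum>i\<in>I. f i x)"
  using assms(2)
  by (induction I rule: infinite_finite_induct) (simp_all add: smooth_on_const[OF assms(1)] smooth_on_add)

lemma smooth_on_vec_nth: "smooth_on S f \<Longrightarrow> smooth_on S (\<lambda>x. f x $ i)"
  by (rule smooth_on_bounded_linear[OF bounded_linear_vec_nth])

lemma smooth_on_partial_deriv: "smooth_on S f \<Longrightarrow> smooth_on S (partial_deriv i f)"
  unfolding smooth_on_def using Ck_on.simps(2) by blast

lemma smooth_on_imp_differentiable: "smooth_on S f \<Longrightarrow> x \<in> S \<Longrightarrow> f differentiable at x"
  unfolding smooth_on_def frechet_derivative_works
  using Ck_on_has_derivative by blast

lemma smooth_on_imp_continuous_on: "smooth_on S f \<Longrightarrow> continuous_on S f"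
  unfolding smooth_on_def using Ck_on.simps(1) by blast

subsection \<open>Linear algebra of a scalar product on the plane\<close>

definition spd :: "real^2^2 \<Rightarrow> bool" where
  "spd G \<longleftrightarrow> transpose G = G \<and> (\<forall>v. v \<noteq> 0 \<longrightarrow> v \<bullet> (G *v v) > 0)"

lemma spd_sym: "spd G \<Longrightarrow> G $ i $ j = G $ j $ i"
  unfolding spd_def transpose_def by (metis vec_lambda_beta)

lemma spd_nonneg: "spd G \<Longrightarrow> v \<bullet> (G *v v) \<ge> 0"
  unfolding spd_def by (cases "v = 0") (auto intro: less_imp_le)

lemma quadratic_form_2:
  fixes G :: "real^2^2"
  shows "v \<bullet> (G *v w) = G $ 1 $ 1 * v $ 1 * w $ 1 + G $ 1 $ 2 * v $ 1 * w $ 2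
    + G $ 2 $ 1 * v $ 2 * w $ 1 + G $ 2 $ 2 * v $ 2 * w $ 2"
  by (simp add: inner_vec_def matrix_vector_mult_def sum_2 algebra_simps)

lemma spd_11_pos:
  assumes "spd G"
  shows "G $ 1 $ 1 > 0"
proof -
  have "axis 1 1 \<noteq> (0 :: real^2)"
    by (simp add: axis_eq_0_iff)
  with assms have "axis 1 1 \<bullet> (G *v axis 1 1) > 0"
    unfolding spd_def by blast
  then show ?thesis
    by (simp add: quadratic_form_2 axis_def)
qed

lemma spd_det_pos:
  assumes "spd G"
  shows "det G > 0"
proof -
  have pos: "v \<bullet> (G *v v) > 0" if "v \<noteq> 0" for v
    using assms that by (simp add: spd_def)
  note a = spd_11_pos[OF assms]
  \<comment> \<open>This vector is \<open>G\<close>-orthogonal to the first axis, and its quadratic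
    form equals \<open>G $ 1 $ 1 * det G\<close>.\<close>
  define w :: "real^2" where "w = vector [- (G $ 1 $ 2), G $ 1 $ 1]"
  have "w \<noteq> 0"
    using a by (auto simp: w_def vec_eq_iff forall_2)
  from pos[OF this] have "G $ 1 $ 1 * det G > 0"
    using spd_sym[OF assms, of 2 1] by (simp add: quadratic_form_2 w_def det_2 algebra_simps)
  with a show ?thesis
    by (simp add: zero_less_mult_iff)
qed

lemma matrix_inv_inverse:
  fixes G :: "real^'n^'n"
  assumes "det G \<noteq> 0"
  shows "G ** matrix_inv G = mat 1" "matrix_inv G ** G = mat 1"
proof -
  have "\<exists>B. G ** B = mat 1 \<and> B ** G = mat 1"
    using assms invertible_det_nz invertible_def by blast
  from someI_ex[OF this] show "G ** matrix_inv G = mat 1" "matrix_inv G ** G = mat 1"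
    unfolding matrix_inv_def by auto
qed

text \<open>Exhibits the entries as rational functions of those of \<open>G\<close>, from which
  their smoothness will follow.\<close>

lemma matrix_inv_2:
  fixes G :: "real^2^2"
  assumes "det G \<noteq> 0"
  shows "matrix_inv G = vector [vector [G $ 2 $ 2 / det G, - (G $ 1 $ 2) / det G],
    vector [- (G $ 2 $ 1) / det G, G $ 1 $ 1 / det G]]" (is "_ = ?B")
proof -
  have "G $ 1 $ 1 * G $ 2 $ 2 - G $ 1 $ 2 * G $ 2 $ 1 = det G"
    "G $ 2 $ 2 * G $ 1 $ 1 - G $ 2 $ 1 * G $ 1 $ 2 = det G"
    by (simp_all add: det_2 algebra_simps)
  then have "G ** ?B = mat 1"
    using assms
    by (simp add: vec_eq_iff forall_2 matrix_matrix_mult_def sum_2 mat_def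
        diff_divide_distrib[symmetric])
  then have "matrix_inv G ** (G ** ?B) = matrix_inv G"
    by simp
  then show ?thesis
    by (simp add: matrix_mul_assoc matrix_inv_inverse[OF assms])
qed

text \<open>The right-hand side is the quarter turn of \<open>G *v v\<close> divided by
  \<open>sqrt (det G)\<close>. To resolve the definite description, this map is shown to act
  correctly on every positive orthonormal frame; any competitor agrees with it on one such frame,
  hence everywhere by linearity.\<close>

lemma complex_structure_eq:
  assumes "spd G"
  shows "complex_structure G v = (1 / sqrt (det G)) *\<^sub>R
    vector [- (G $ 1 $ 2 * v $ 1 + G $ 2 $ 2 * v $ 2), G $ 1 $ 1 * v $ 1 + G $ 1 $ 2 * v $ 2]"
proof -
  define a b c where "a = G $ 1 $ 1" and "b = G $ 1 $ 2" and "c = G $ 2 $ 2"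
  have ba: "G $ 2 $ 1 = b"
    using spd_sym[OF assms, of 2 1] by (simp add: b_def)
  define d where "d = sqrt (det G)"
  have detG: "det G = a * c - b * b"
    by (simp add: det_2 a_def c_def ba b_def[symmetric])
  have d: "d > 0" "d * d = a * c - b * b"
    using spd_det_pos[OF assms] by (simp_all add: d_def detG)
  define J :: "real^2 \<Rightarrow> real^2" where
    "J = (\<lambda>v. (1 / d) *\<^sub>R vector [- (b * v $ 1 + c * v $ 2), a * v $ 1 + b * v $ 2])"
  have linJ: "linear J"
    using d(1) by (intro linearI) (simp_all add: J_def vec_eq_iff forall_2 field_simps)
  have frame: "J e1 = e2 \<and> J e2 = - e1" if "positive_orthonormal G e1 e2" for e1 e2
  proof -
    obtain p q r s where e: "e1 $ 1 = p" "e1 $ 2 = q" "e2 $ 1 = r" "e2 $ 2 = s" by blast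
    define D where "D = p * s - q * r"
    define u v u' v' where "u = a * p + b * q" and "v = b * p + c * q"
      and "u' = a * r + b * s" and "v' = b * r + c * s"
    have eqs: "p * u + q * v = 1" "r * u + s * v = 0" "p * u' + q * v' = 0" "r * u' + s * v' = 1"
      and "D > 0"
      using that unfolding positive_orthonormal_def quadratic_form_2 e ba
        a_def[symmetric] b_def[symmetric] c_def[symmetric]
      by (simp_all add: u_def v_def u'_def v'_def D_def det_2 e algebra_simps)
    \<comment> \<open>Cramer's rule: \<open>(u, v)\<close> and \<open>(u', v')\<close> are the
      images of \<open>e1\<close> and \<open>e2\<close> under \<open>G\<close>, and
      \<open>eqs\<close> says that they form the dual basis of the frame.\<close>
    have Du: "D * u = s" "D * v = - r" "D * u' = - q" "D * v' = p"
      using eqs unfolding D_def by algebra+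
    \<comment> \<open>The Gram matrix of an orthonormal frame has determinant 1.\<close>
    have "D * D * (a * c - b * b) = 1"
    proof -
      have "D * (a * c - b * b) * D = D * (u * v' - v * u')"
        unfolding D_def u_def v_def u'_def v'_def by algebra
      also have "\<dots> = (D * u) * v' - (D * v) * u'"
        by algebra
      also have "\<dots> = 1"
        using eqs(4) by (simp add: Du algebra_simps)
      finally show ?thesis by algebra
    qed
    then have "(D * d) * (D * d) = 1"
      using d(2) by algebra
    \<comment> \<open>Positive orientation excludes the root -1.\<close>
    moreover have "D * d > 0"
      using \<open>D > 0\<close> d(1) by simp
    ultimately have "D * d = 1"
      using square_eq_1_iff[of "D * d"] by auto
    then have "D = 1 / d"
      using d(1) by (simp add: field_simps)
    then have "J e1 = vector [- (D * v), D * u]" "J e2 = vector [- (D * v'), D * u']"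
      by (simp_all add: J_def e u_def v_def u'_def v'_def vec_eq_iff forall_2 del: minus_add_distrib)
    then show ?thesis
      by (simp add: Du vec_eq_iff forall_2 e)
  qed
  text \<open>The Gram-Schmidt frame built on the first coordinate vector.\<close>
  define f1 f2 :: "real^2" where
    "f1 = vector [1 / sqrt a, 0]" and "f2 = vector [- b / (sqrt a * d), sqrt a / d]"
  have a: "a > 0"
    using spd_11_pos[OF assms] by (simp add: a_def)
  have sa: "sqrt a * sqrt a = a" "sqrt a > 0" using a by simp_all
  have f: "positive_orthonormal G f1 f2"
  proof -
    have c: "c = (d * d + b * b) / a"
      using a d(2) by (simp add: field_simps)
    have "sqrt a * (sqrt a * z) = a * z" for z
      using sa(1) by (simp add: mult.assoc[symmetric])
    then show ?thesis
      unfolding positive_orthonormal_def quadratic_form_2 ba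
        a_def[symmetric] b_def[symmetric] c_def[symmetric] c f1_def f2_def
      using sa d(1) a by (simp add: det_2 field_simps)
  qed
  have "complex_structure G = J"
    unfolding complex_structure_def
  proof (rule the_equality)
    show "linear J \<and> (\<forall>e1 e2. positive_orthonormal G e1 e2 \<longrightarrow> J e1 = e2 \<and> J e2 = - e1)"
      using linJ frame by blast
  next
    fix L assume L: "linear L \<and> (\<forall>e1 e2. positive_orthonormal G e1 e2 \<longrightarrow> L e1 = e2 \<and> L e2 = - e1)"
    then have eq: "L f1 = J f1" "L f2 = J f2"
      using f frame by simp_all
    show "L = J"
    proof
      fix v :: "real^2"
      \<comment> \<open>Expansion in the orthonormal frame; the coefficients are the
        \<open>G\<close>-products of \<open>v\<close> with \<open>f1\<close> and
        \<open>f2\<close>.\<close>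
      have v: "v = (sqrt a * v $ 1 + b / sqrt a * v $ 2) *\<^sub>R f1 + (d / sqrt a * v $ 2) *\<^sub>R f2"
        using sa d by (simp add: f1_def f2_def vec_eq_iff forall_2 field_simps)
      show "L v = J v"
        using L linJ eq by (subst (1 2) v) (simp add: linear_add linear_cmul)
    qed
  qed
  then show ?thesis
    by (simp add: J_def a_def b_def c_def d_def)
qed

text \<open>By symmetry of \<open>G\<close> this is the Euclidean product of \<open>G *v v\<close>
  with a multiple of its own quarter turn.\<close>

lemma complex_structure_orthogonal:
  assumes "spd G"
  shows "v \<bullet> (G *v complex_structure G v) = 0"
  using spd_sym[OF assms, of 2 1]
  by (simp add: complex_structure_eq[OF assms] quadratic_form_2 algebra_simps)

subsection \<open>The curvature in coordinates\<close>

lemma smooth_on_matrix_inv: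
  assumes "smooth_on S G" "\<And>x. x \<in> S \<Longrightarrow> det (G x :: real^2^2) \<noteq> 0"
  shows "smooth_on S (\<lambda>x. matrix_inv (G x) $ i $ j)"
proof -
  note opn = smooth_on_open[OF assms(1)]
  have comp: "smooth_on S (\<lambda>x. G x $ i $ j)" for i j
    by (intro smooth_on_vec_nth assms(1))
  have det: "smooth_on S (\<lambda>x. det (G x))"
    unfolding det_2 by (intro smooth_on_diff smooth_on_mult comp)
  have neg: "smooth_on S (\<lambda>x. - (G x $ i $ j))" for i j
    using smooth_on_diff[OF smooth_on_const[OF opn, of 0] comp] by simp
  \<comment> \<open>The condition depends only on the indices, so the four entries of the inverse
    can be treated by one rule.\<close>
  have ite: "smooth_on S (\<lambda>x. if P then f x else g x)"
    if "smooth_on S f" "smooth_on S g" for P and f g :: "real^2 \<Rightarrow> real"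
    using that by (cases P) simp_all
  have entry: "matrix_inv (G x) $ i $ j = (if i = 1 then if j = 1 then G x $ 2 $ 2 / det (G x)
      else - (G x $ 1 $ 2) / det (G x) else if j = 1 then - (G x $ 2 $ 1) / det (G x)
      else G x $ 1 $ 1 / det (G x))" if "x \<in> S" for x
    using exhaust_2[of i] exhaust_2[of j] by (auto simp: matrix_inv_2[OF assms(2)[OF that]])
  show ?thesis
    by (rule iffD2[OF smooth_on_cong[OF opn entry]], assumption)
      (intro ite smooth_on_divide comp neg det assms(2))
qed

lemma smooth_on_christoffel:
  assumes "smooth_on S G" "\<And>x. x \<in> S \<Longrightarrow> det (G x) \<noteq> 0"
  shows "smooth_on S (christoffel G k i j)"
  unfolding christoffel_def[abs_def]
  by (intro smooth_on_divide smooth_on_sum smooth_on_mult smooth_on_add smooth_on_diff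
      smooth_on_matrix_inv smooth_on_vec_nth smooth_on_partial_deriv smooth_on_const
      smooth_on_open[OF assms(1)] assms) auto

lemma smooth_on_coord_curvature:
  assumes "smooth_on S G" "\<And>x. x \<in> S \<Longrightarrow> det (G x) \<noteq> 0"
  shows "smooth_on S (coord_curvature G)"
proof -
  have "smooth_on S (riemann G l i j k)" for l i j k
    unfolding riemann_def[abs_def]
    by (intro smooth_on_add smooth_on_diff smooth_on_sum smooth_on_mult smooth_on_partial_deriv
        smooth_on_christoffel smooth_on_open[OF assms(1)] assms)
  then show ?thesis
    unfolding coord_curvature_def[abs_def] det_2
    by (intro smooth_on_divide smooth_on_sum smooth_on_diff smooth_on_mult smooth_on_vec_nth
        smooth_on_open[OF assms(1)] assms) (use assms(2) in \<open>auto simp: det_2\<close>)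
qed

text \<open>Curvature is local. This allows the metric of a chart, known only on the chart image, to
  be replaced by a formula on the whole coordinate plane.\<close>

lemma coord_curvature_cong:
  assumes "open S" "\<And>x. x \<in> S \<Longrightarrow> G x = H x" "x \<in> S"
  shows "coord_curvature G x = coord_curvature H x"
proof -
  \<comment> \<open>Equality on all of \<open>S\<close>, and not just at \<open>x\<close>, because
    \<open>riemann\<close> differentiates these symbols.\<close>
  have "christoffel G k i j y = christoffel H k i j y" if "y \<in> S" for k i j y
    unfolding christoffel_def using partial_deriv_cong[OF assms(1) that assms(2)] assms(2)[OF that]
    by simp
  then have "riemann G l i j k x = riemann H l i j k x" for l i j k
    unfolding riemann_def
    using partial_deriv_cong[OF assms(1,3), of "christoffel G l j k" "christoffel H l j k" for j]
      assms(3) by simp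
  then show ?thesis
    unfolding coord_curvature_def using assms(2)[OF assms(3)] by simp
qed

text \<open>A translation has the identity as derivative. Both functions thus have the same
  derivatives, and the choice agrees even at points of non-differentiability.\<close>

lemma partial_deriv_shift:
  "partial_deriv i f (x + h) = partial_deriv i (\<lambda>y. f (y + h)) x"
proof -
  have "(f has_derivative D) (at (x + h)) \<longleftrightarrow> ((\<lambda>y. f (y + h)) has_derivative D) (at x)" for D
  proof
    assume "(f has_derivative D) (at (x + h))"
    from has_derivative_compose[OF has_derivative_add_const[OF has_derivative_ident], OF this]
    show "((\<lambda>y. f (y + h)) has_derivative D) (at x)" .
  next
    assume D: "((\<lambda>y. f (y + h)) has_derivative D) (at x)"
    have "((\<lambda>z. z - h) has_derivative (\<lambda>z. z)) (at (x + h))"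
      by (auto intro!: derivative_eq_intros)
    from has_derivative_compose[OF this, of "\<lambda>y. f (y + h)" D] D
    show "(f has_derivative D) (at (x + h))" by simp
  qed
  then show ?thesis
    by (simp add: partial_deriv_def frechet_derivative_def)
qed

lemma coord_curvature_periodic:
  assumes "\<And>y. G (y + h) = G y"
  shows "coord_curvature G (x + h) = coord_curvature G x"
proof -
  have pd: "partial_deriv i f (y + h) = partial_deriv i f y" if "\<And>y. f (y + h) = f y"
    for f :: "real^2 \<Rightarrow> 'b::real_normed_vector" and i y
    by (simp add: partial_deriv_shift that)
  have pdG: "partial_deriv i G (y + h) = partial_deriv i G y" for i y
    by (simp add: partial_deriv_shift assms)
  have ch: "christoffel G k i j (y + h) = christoffel G k i j y" for k i j y
    by (simp add: christoffel_def pdG assms)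
  have "partial_deriv m (christoffel G k i j) (y + h) = partial_deriv m (christoffel G k i j) y"
    for m k i j y
    by (simp add: partial_deriv_shift ch)
  then show ?thesis
    by (simp add: coord_curvature_def riemann_def ch assms)
qed

subsection \<open>The conserved energy\<close>

lemma has_vector_derivative_partial:
  assumes "f differentiable at (x t)" "(x has_vector_derivative w) (at t)"
  shows "((\<lambda>s. f (x s)) has_vector_derivative (\<Sum>i\<in>UNIV. w $ i *\<^sub>R partial_deriv i f (x t))) (at t)"
  using has_derivative_compose[OF assms(2)[unfolded has_vector_derivative_def]
      has_derivative_partial[OF assms(1)]]
  by (simp add: has_vector_derivative_def scaleR_sum_right)

text \<open>Lowering the index cancels the inverse metric. Contracted with \<open>v\<close> three
  times, the three derivative terms of the Christoffel symbol become equal; two enter with plus and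
  one with minus, so one half of a single term remains.\<close>

lemma christoffel_contraction:
  assumes "det (G x) \<noteq> 0"
  shows "v \<bullet> (G x *v (\<chi> k. \<Sum>i\<in>UNIV. \<Sum>j\<in>UNIV. christoffel G k i j x * v $ i * v $ j)) =
    (\<Sum>l\<in>UNIV. v $ l *\<^sub>R (v \<bullet> (partial_deriv l G x *v v))) / 2"
proof -
  define P where "P l i j = partial_deriv l G x $ i $ j" for l i j
  define S where "S i j l = P i j l + P j i l - P l i j" for i j l
  define T :: "real^2" where "T = (\<chi> l. (\<Sum>i\<in>UNIV. \<Sum>j\<in>UNIV. S i j l * v $ i * v $ j) / 2)"
  have ch: "christoffel G k i j x = (\<Sum>l\<in>UNIV. matrix_inv (G x) $ k $ l * S i j l) / 2" for k i j
    by (simp add: christoffel_def S_def P_def)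
  have "(\<chi> k. \<Sum>i\<in>UNIV. \<Sum>j\<in>UNIV. christoffel G k i j x * v $ i * v $ j) = matrix_inv (G x) *v T"
    unfolding vec_eq_iff matrix_vector_mult_def ch T_def vec_lambda_beta sum_2
    apply (intro allI) apply (simp add: field_simps) done
  then have "v \<bullet> (G x *v (\<chi> k. \<Sum>i\<in>UNIV. \<Sum>j\<in>UNIV. christoffel G k i j x * v $ i * v $ j)) = v \<bullet> T"
    by (simp add: matrix_vector_mul_assoc matrix_inv_inverse[OF assms])
  also have "\<dots> = (\<Sum>l\<in>UNIV. v $ l *\<^sub>R (v \<bullet> (partial_deriv l G x *v v))) / 2"
    unfolding T_def S_def inner_vec_def matrix_vector_mult_def vec_lambda_beta sum_2 P_def[symmetric]
      inner_real_def real_scaleR_def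
by (simp add: field_simps)
  finally show ?thesis .
qed

text \<open>Together with \<open>christoffel_contraction\<close> this is compatibility of the
  connection with the metric: the sum is twice the product of \<open>v\<close> with the Christoffel
  term.\<close>

lemma quadratic_form_has_derivative:
  assumes "G differentiable at (x t)" "spd (G (x t))"
    and x: "(x has_vector_derivative v t) (at t)" and v: "(v has_vector_derivative a) (at t)"
  shows "((\<lambda>s. v s \<bullet> (G (x s) *v v s)) has_real_derivative
    (\<Sum>l\<in>UNIV. v t $ l *\<^sub>R (v t \<bullet> (partial_deriv l G (x t) *v v t))) + 2 * (v t \<bullet> (G (x t) *v a))) (at t)"
proof -
  have sym: "G (x t) $ 2 $ 1 = G (x t) $ 1 $ 2"
    by (rule spd_sym[OF assms(2)])
  have nthG: "((\<lambda>s. G (x s) $ i) has_vector_derivative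
      (\<Sum>l\<in>UNIV. v t $ l *\<^sub>R partial_deriv l G (x t)) $ i) (at t)" for i
    by (rule bounded_linear.has_vector_derivative[OF bounded_linear_vec_nth
          has_vector_derivative_partial[of G x t, OF assms(1) x]])
  have dG: "((\<lambda>s. G (x s) $ i $ j) has_real_derivative
      v t $ 1 * partial_deriv 1 G (x t) $ i $ j + v t $ 2 * partial_deriv 2 G (x t) $ i $ j) (at t)" for i j
    using bounded_linear.has_vector_derivative[OF bounded_linear_vec_nth[of j] nthG[of i]]
    by (simp add: has_real_derivative_iff_has_vector_derivative sum_2)
  have dv: "((\<lambda>s. v s $ i) has_real_derivative a $ i) (at t)" for i
    using bounded_linear.has_vector_derivative[OF bounded_linear_vec_nth v, of i]
    by (simp add: has_real_derivative_iff_has_vector_derivative)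
  show ?thesis
    unfolding quadratic_form_2
    by (rule derivative_eq_intros dG dv refl)+ (simp add: sum_2 sym algebra_simps)
qed

text \<open>\<open>J v\<close> is orthogonal to \<open>v\<close>, and the gradient term cancels the derivative of \<open>C\<^sup>2 f\<^sup>2\<close>.\<close>
lemma energy_has_derivative_zero:
  assumes G: "G differentiable at (x t)" "spd (G (x t))" and f: "f differentiable at (x t)"
    and x: "(x has_vector_derivative v t) (at t)" and v: "(v has_vector_derivative a) (at t)"
    and eq: "a + (\<chi> k. \<Sum>i\<in>UNIV. \<Sum>j\<in>UNIV. christoffel G k i j (x t) * v t $ i * v t $ j) =
      (C * f (x t)) *\<^sub>R complex_structure (G (x t)) (v t)
      - (C\<^sup>2 * f (x t)) *\<^sub>R (matrix_inv (G (x t)) *v (\<chi> j. partial_deriv j f (x t)))"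
  shows "((\<lambda>s. v s \<bullet> (G (x s) *v v s) + C\<^sup>2 * (f (x s))\<^sup>2) has_real_derivative 0) (at t)"
proof -
  have det: "det (G (x t)) \<noteq> 0"
    using spd_det_pos[OF G(2)] by simp
  define Q where "Q = (\<Sum>l\<in>UNIV. v t $ l *\<^sub>R (v t \<bullet> (partial_deriv l G (x t) *v v t)))"
  define df where "df = (\<Sum>i\<in>UNIV. v t $ i *\<^sub>R partial_deriv i f (x t))"
  have "a = (C * f (x t)) *\<^sub>R complex_structure (G (x t)) (v t)
      - (C\<^sup>2 * f (x t)) *\<^sub>R (matrix_inv (G (x t)) *v (\<chi> j. partial_deriv j f (x t)))
      - (\<chi> k. \<Sum>i\<in>UNIV. \<Sum>j\<in>UNIV. christoffel G k i j (x t) * v t $ i * v t $ j)"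
    using eq by (simp add: algebra_simps)
  \<comment> \<open>The product with the gradient is the derivative of \<open>f\<close> along the
    curve.\<close>
  moreover have "v t \<bullet> (G (x t) *v (matrix_inv (G (x t)) *v (\<chi> j. partial_deriv j f (x t)))) = df"
    by (simp add: matrix_vector_mul_assoc matrix_inv_inverse[OF det] inner_vec_def df_def)
  \<comment> \<open>Doubled, the term \<open>- Q / 2\<close> will cancel the derivative of the
    metric coefficients.\<close>
  ultimately have a: "v t \<bullet> (G (x t) *v a) = - (C\<^sup>2 * f (x t)) * df - Q / 2"
    using complex_structure_orthogonal[OF G(2), of "v t"] christoffel_contraction[of G "x t" "v t", OF det]
    by (simp add: matrix_vector_mult_diff_distrib inner_diff_right matrix_vector_mult_scaleR Q_def)
  have "((\<lambda>s. f (x s)) has_real_derivative df) (at t)"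
    using has_vector_derivative_partial[of f x t, OF f x]
    by (simp add: has_real_derivative_iff_has_vector_derivative df_def)
  then have "((\<lambda>s. C\<^sup>2 * (f (x s))\<^sup>2) has_real_derivative 2 * C\<^sup>2 * f (x t) * df) (at t)"
    by (auto intro!: derivative_eq_intros)
  from DERIV_add[OF quadratic_form_has_derivative[of G x t v, OF G x v] this]
  show ?thesis
    by (simp add: a Q_def)
qed

subsection \<open>Curves in charts\<close>

lemma surface_metric:
  assumes "oriented_riemannian_surface M" "c \<in> charts M"
  shows "smooth_on (coord c ` cdom c) (metric M c)"
    and "x \<in> coord c ` cdom c \<Longrightarrow> spd (metric M c x)"
  using assms unfolding oriented_riemannian_surface_def riemannian_metric_def spd_def by blast+

lemma chart_topological:
  assumes "oriented_riemannian_surface M" "c \<in> charts M"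
  shows "topological_chart (stop M) c"
  using assms unfolding oriented_riemannian_surface_def oriented_smooth_surface_def by blast

lemma chart_cinv:
  assumes "oriented_riemannian_surface M" "c \<in> charts M" "p \<in> cdom c"
  shows "cinv c (coord c p) = p"
proof -
  have "openin (stop M) (cdom c)"
    and h: "homeomorphic_map (subtopology (stop M) (cdom c)) (top_of_set (coord c ` cdom c)) (coord c)"
    using chart_topological[OF assms(1,2)] by (auto simp: topological_chart_def)
  then have "topspace (subtopology (stop M) (cdom c)) = cdom c"
    using openin_subset by fastforce
  then have "inj_on (coord c) (cdom c)"
    using homeomorphic_imp_injective_map[OF h] by simp
  then show ?thesis
    using assms(3) by (rule inv_into_f_f)
qed

lemma surface_covered:
  assumes "oriented_riemannian_surface M" "p \<in> topspace (stop M)"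
  obtains c where "c \<in> charts M" "p \<in> cdom c"
  using assms unfolding oriented_riemannian_surface_def oriented_smooth_surface_def by blast

lemma curve_locally_in_chart:
  assumes "oriented_riemannian_surface M" "c \<in> charts M" "continuous_map (top_of_set T) (stop M) \<gamma>"
    and "open T" "t \<in> T" "\<gamma> t \<in> cdom c"
  obtains U where "open U" "t \<in> U" "U \<subseteq> T" "\<And>s. s \<in> U \<Longrightarrow> \<gamma> s \<in> cdom c"
proof
  let ?U = "{s \<in> T. \<gamma> s \<in> cdom c}"
  have "openin (stop M) (cdom c)"
    using chart_topological[OF assms(1,2)] by (simp add: topological_chart_def)
  from openin_continuous_map_preimage[OF assms(3) this] show "open ?U"
    using assms(4) by (simp add: openin_open_eq)
qed (use assms in auto)

lemma velocity_has_derivative: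
  assumes "twice_differentiable_curve M T \<gamma>" "t \<in> T" "c \<in> charts M" "\<gamma> t \<in> cdom c"
  shows "((\<lambda>s. coord c (\<gamma> s)) has_vector_derivative velocity c \<gamma> t) (at t)"
    and "(velocity c \<gamma> has_vector_derivative vector_derivative (velocity c \<gamma>) (at t)) (at t)"
proof -
  have "(coord c \<circ> \<gamma>) differentiable (at t)" "velocity c \<gamma> differentiable (at t)"
    using assms unfolding twice_differentiable_curve_def by blast+
  then show "((\<lambda>s. coord c (\<gamma> s)) has_vector_derivative velocity c \<gamma> t) (at t)"
    "(velocity c \<gamma> has_vector_derivative vector_derivative (velocity c \<gamma>) (at t)) (at t)"
    unfolding vector_derivative_works by (simp_all add: velocity_def o_def)
qed

text \<open>Chain rule for \<open>coord d\<close> written as the transition map after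
  \<open>coord c\<close>; this factorization holds as long as the curve stays in the domain of
  \<open>c\<close>, hence on a neighbourhood of \<open>t\<close>.\<close>

lemma velocity_transition:
  assumes M: "oriented_riemannian_surface M" and cd: "c \<in> charts M" "d \<in> charts M"
    and \<gamma>: "twice_differentiable_curve M T \<gamma>" and T: "open T" "t \<in> T"
    and t: "\<gamma> t \<in> cdom c" "\<gamma> t \<in> cdom d"
  shows "velocity d \<gamma> t = jacobian (transition c d) (at (coord c (\<gamma> t))) *v velocity c \<gamma> t"
proof -
  have cont: "continuous_map (top_of_set T) (stop M) \<gamma>"
    using \<gamma> by (simp add: twice_differentiable_curve_def)
  obtain U where U: "open U" "t \<in> U" "\<And>s. s \<in> U \<Longrightarrow> \<gamma> s \<in> cdom c"
    using curve_locally_in_chart[OF M cd(1) cont T t(1)] by metis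
  have "oriented_transition c d"
    using M cd unfolding oriented_riemannian_surface_def oriented_smooth_surface_def by blast
  then have "transition c d differentiable at (coord c (\<gamma> t))"
    unfolding oriented_transition_def
    using smooth_on_imp_differentiable t by blast
  then have D: "(transition c d has_derivative (*v) (jacobian (transition c d) (at (coord c (\<gamma> t)))))
      (at (coord c (\<gamma> t)))"
    by (simp add: jacobian_works)
  have "((\<lambda>s. transition c d (coord c (\<gamma> s))) has_vector_derivative
      jacobian (transition c d) (at (coord c (\<gamma> t))) *v velocity c \<gamma> t) (at t)"
    using has_derivative_compose[OF
        velocity_has_derivative(1)[OF \<gamma> T(2) cd(1) t(1), unfolded has_vector_derivative_def] D]
    by (simp add: has_vector_derivative_def matrix_vector_mult_scaleR)
  then have "((\<lambda>s. coord d (\<gamma> s)) has_vector_derivative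
      jacobian (transition c d) (at (coord c (\<gamma> t))) *v velocity c \<gamma> t) (at t)"
    by (rule has_vector_derivative_transform_within_open[OF _ U(1,2)])
      (simp add: transition_def chart_cinv[OF M cd(1) U(3)])
  with velocity_has_derivative(1)[OF \<gamma> T(2) cd(2) t(2)] show ?thesis
    by (rule vector_derivative_unique_at)
qed

text \<open>\<open>speed\<close> selects a chart separately at each time. The transformation laws of
  metric and velocity cancel, so near \<open>t\<close> the squared speed can be computed, and
  differentiated, in one fixed chart.\<close>

lemma speed_in_chart:
  assumes M: "oriented_riemannian_surface M" and c: "c \<in> charts M"
    and \<gamma>: "twice_differentiable_curve M T \<gamma>" and T: "open T" "t \<in> T"
    and t: "\<gamma> t \<in> cdom c"
  shows "(speed M \<gamma> t)\<^sup>2 = velocity c \<gamma> t \<bullet> (metric M c (coord c (\<gamma> t)) *v velocity c \<gamma> t)"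
proof -
  define d where "d = (SOME c. c \<in> charts M \<and> \<gamma> t \<in> cdom c)"
  have d: "d \<in> charts M" "\<gamma> t \<in> cdom d"
    unfolding d_def using someI[of "\<lambda>c. c \<in> charts M \<and> \<gamma> t \<in> cdom c" c] c t by blast+
  define D where "D = jacobian (transition c d) (at (coord c (\<gamma> t)))"
  have "metric M c (coord c (\<gamma> t)) = transpose D ** metric M d (coord d (\<gamma> t)) ** D"
    using M c d t unfolding oriented_riemannian_surface_def riemannian_metric_def D_def Let_def
    by blast
  moreover have "u \<bullet> (transpose D *v w) = (D *v u) \<bullet> w" for u w
    by (metis dot_lmul_matrix inner_commute transpose_matrix_vector)
  ultimately have "velocity c \<gamma> t \<bullet> (metric M c (coord c (\<gamma> t)) *v velocity c \<gamma> t) =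
      (D *v velocity c \<gamma> t) \<bullet> (metric M d (coord d (\<gamma> t)) *v (D *v velocity c \<gamma> t))"
    by (simp only: matrix_vector_mul_assoc[symmetric])
  also have "D *v velocity c \<gamma> t = velocity d \<gamma> t"
    unfolding D_def by (rule velocity_transition[OF M c d(1) \<gamma> T t d(2), symmetric])
  also have "velocity d \<gamma> t \<bullet> (metric M d (coord d (\<gamma> t)) *v velocity d \<gamma> t) = (speed M \<gamma> t)\<^sup>2"
    using spd_nonneg[OF surface_metric(2)[OF M d(1)]] d(2)
    by (simp add: speed_def Let_def d_def[symmetric])
  finally show ?thesis ..
qed

section \<open>Curvature in charts and conservation of energy along a solution\<close>

lemma curvature_in_chart:
  assumes M: "oriented_riemannian_surface M" "is_curvature M K" and c: "c \<in> charts M"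
    and x: "x \<in> coord c ` cdom c"
  shows "K (cinv c x) = coord_curvature (metric M c) x"
  using M(2) c inv_into_into[OF x] f_inv_into_f[OF x] unfolding is_curvature_def by metis

lemma smooth_on_curvature:
  assumes "oriented_riemannian_surface M" "c \<in> charts M"
  shows "smooth_on (coord c ` cdom c) (coord_curvature (metric M c))"
  using surface_metric[OF assms] spd_det_pos by (intro smooth_on_coord_curvature) force+

lemma solution_energy_constant:
  assumes M: "oriented_riemannian_surface M" "is_curvature M K"
    and \<gamma>: "solution_curve M K C T \<gamma>" and T: "open T" "convex T" "s \<in> T" "t \<in> T"
  shows "(speed M \<gamma> s)\<^sup>2 + C\<^sup>2 * (K (\<gamma> s))\<^sup>2 = (speed M \<gamma> t)\<^sup>2 + C\<^sup>2 * (K (\<gamma> t))\<^sup>2"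
proof -
  let ?E = "\<lambda>s. (speed M \<gamma> s)\<^sup>2 + C\<^sup>2 * (K (\<gamma> s))\<^sup>2"
  have tw: "twice_differentiable_curve M T \<gamma>"
    using \<gamma> by (simp add: solution_curve_def)
  then have cont: "continuous_map (top_of_set T) (stop M) \<gamma>"
    by (simp add: twice_differentiable_curve_def)
  have "(?E has_real_derivative 0) (at t)" if t: "t \<in> T" for t
  proof -
    have "\<gamma> t \<in> topspace (stop M)"
      using cont t by (auto simp: continuous_map_def)
    then obtain c where c: "c \<in> charts M" "\<gamma> t \<in> cdom c"
      using surface_covered[OF M(1)] by blast
    obtain U where U: "open U" "t \<in> U" "U \<subseteq> T" "\<And>s. s \<in> U \<Longrightarrow> \<gamma> s \<in> cdom c"
      using curve_locally_in_chart[OF M(1) c(1) cont T(1) t c(2)] by metis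
    define G where "G = metric M c"
    define f where "f = coord_curvature G"
    define x where "x = (\<lambda>s. coord c (\<gamma> s))"
    note K = M(2)[unfolded is_curvature_def, rule_format, OF c(1), folded G_def f_def]
    have xt: "x t \<in> coord c ` cdom c"
      using c by (simp add: x_def)
    note opn = smooth_on_open[OF surface_metric(1)[OF M(1) c(1)]]
    \<comment> \<open>The gradient is defined from \<open>K\<close> on the surface; in the chart it
      becomes the gradient of the smooth function \<open>f\<close>.\<close>
    have pd: "partial_deriv j (K \<circ> cinv c) (x t) = partial_deriv j f (x t)" for j
      by (rule partial_deriv_cong[OF opn xt])
        (simp add: curvature_in_chart[OF M c(1)] f_def G_def)
    have "covariant_acceleration M c \<gamma> t = (C * K (\<gamma> t)) *\<^sub>R
        complex_structure (metric M c (coord c (\<gamma> t))) (velocity c \<gamma> t)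
        - (C\<^sup>2 * K (\<gamma> t)) *\<^sub>R grad M c K (\<gamma> t)"
      using \<gamma> t c unfolding solution_curve_def by blast
    then have eq: "vector_derivative (velocity c \<gamma>) (at t) + (\<chi> k. \<Sum>i\<in>UNIV. \<Sum>j\<in>UNIV.
          christoffel G k i j (x t) * velocity c \<gamma> t $ i * velocity c \<gamma> t $ j) =
        (C * f (x t)) *\<^sub>R complex_structure (G (x t)) (velocity c \<gamma> t)
        - (C\<^sup>2 * f (x t)) *\<^sub>R (matrix_inv (G (x t)) *v (\<chi> j. partial_deriv j f (x t)))"
      unfolding covariant_acceleration_def grad_def
      by (simp add: G_def[symmetric] K[OF c(2)] pd[unfolded x_def] x_def)
    have "((\<lambda>s. velocity c \<gamma> s \<bullet> (G (x s) *v velocity c \<gamma> s) + C\<^sup>2 * (f (x s))\<^sup>2)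
        has_real_derivative 0) (at t)"
      by (rule energy_has_derivative_zero[where G = G and f = f and x = x and v = "velocity c \<gamma>"
            and C = C and t = t, OF _ _ _ _ _ eq])
        (use velocity_has_derivative[OF tw t c] surface_metric[OF M(1) c(1)] xt
           smooth_on_imp_differentiable[OF surface_metric(1)[OF M(1) c(1)] xt]
           smooth_on_imp_differentiable[OF smooth_on_curvature[OF M(1) c(1)] xt]
         in \<open>simp_all add: G_def f_def x_def\<close>)
    \<comment> \<open>On \<open>U\<close> the energy coincides with its expression in the chart
      \<open>c\<close>, so the derivative carries over.\<close>
    then show ?thesis
      by (rule has_field_derivative_transform_within_open[OF _ U(1,2)])
        (use U(3,4) in \<open>auto simp: speed_in_chart[OF M(1) c(1) tw T(1)] K G_def x_def\<close>)
  qed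
  then have "\<exists>e. \<forall>t\<in>T. ?E t = e"
    by (rule has_field_derivative_zero_constant[OF T(2) has_field_derivative_at_within])
  with T(3,4) show ?thesis
    by metis
qed

lemma convex_einterval: "convex (einterval a b)"
proof -
  have "a < ereal x \<and> ereal x < b" if "a < ereal r" "ereal s < b" "r \<le> x" "x \<le> s" for r s x
    using less_le_trans[of a "ereal r" "ereal x"] le_less_trans[of "ereal x" "ereal s" b] that
    by simp
  then have "is_interval (einterval a b)"
    unfolding is_interval_1 einterval_iff Ball_def by blast
  then show ?thesis
    by (rule is_interval_convex)
qed

subsection \<open>Surfaces of revolution\<close>

text \<open>The local metric does not depend on the angle, so neither does the curvature.\<close>
lemma curvature_surface_of_revolution:
  assumes M: "oriented_riemannian_surface M" "is_curvature M K"
    and X: "surface_of_revolution M X I A"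
  obtains \<kappa> where "continuous_on I \<kappa>" "\<And>u. u $ 2 \<in> I \<Longrightarrow> K (X u) = \<kappa> (u $ 2)"
proof
  define G :: "real^2 \<Rightarrow> real^2^2" where
    "G = (\<lambda>w. vector [vector [(A (w $ 2))\<^sup>2, 0], vector [0, 1]])"
  \<comment> \<open>The curvature formula along the meridian with angle 0, for the single metric
    \<open>G\<close> on the coordinate plane that all the local charts share.\<close>
  define \<kappa> where "\<kappa> r = coord_curvature G (vector [0, r])" for r
  have local: "\<exists>W. open W \<and> u \<in> W \<and> (\<forall>w\<in>W. w $ 2 \<in> I \<and> K (X w) = coord_curvature G w) \<and>
      continuous_on W (coord_curvature G)" if u: "u $ 2 \<in> I" for u
  proof -
    have "\<exists>W. open W \<and> u \<in> W \<and> (\<forall>w \<in> W. w $ 2 \<in> I) \<and>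
        (\<exists>c \<in> charts M. cdom c = X ` W \<and> (\<forall>w \<in> W. coord c (X w) = w \<and> metric M c w = G w))"
      using X u unfolding surface_of_revolution_def G_def by simp
    then obtain W c where W: "open W" "u \<in> W" "\<And>w. w \<in> W \<Longrightarrow> w $ 2 \<in> I"
      and c: "c \<in> charts M" "cdom c = X ` W"
      and cX: "\<And>w. w \<in> W \<Longrightarrow> coord c (X w) = w" and cG: "\<And>w. w \<in> W \<Longrightarrow> metric M c w = G w"
      by auto
    have im: "coord c ` cdom c = W"
      using cX by (force simp: c(2))
    have eq: "coord_curvature (metric M c) w = coord_curvature G w" if "w \<in> W" for w
      using coord_curvature_cong[OF W(1) cG that] .
    have "K (X w) = coord_curvature G w" if "w \<in> W" for w
      using M(2) c that cX[OF that] eq[OF that] unfolding is_curvature_def by auto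
    moreover have "continuous_on W (coord_curvature G)"
      using smooth_on_imp_continuous_on[OF smooth_on_curvature[OF M(1) c(1)]] eq
      by (simp add: im cong: continuous_on_cong)
    ultimately show ?thesis
      using W by blast
  qed
  \<comment> \<open>Every point arises from the meridian by a shift of the angle, which leaves
    \<open>G\<close> unchanged.\<close>
  have rot: "coord_curvature G u = \<kappa> (u $ 2)" for u
  proof -
    have "u = vector [0, u $ 2] + axis 1 (u $ 1)"
      by (simp add: vec_eq_iff forall_2 axis_def)
    moreover have "coord_curvature G (vector [0, u $ 2] + axis 1 (u $ 1)) = \<kappa> (u $ 2)"
      unfolding \<kappa>_def by (rule coord_curvature_periodic) (simp add: G_def axis_def)
    ultimately show ?thesis by simp
  qed
  show "K (X u) = \<kappa> (u $ 2)" if "u $ 2 \<in> I" for u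
    using local[OF that] rot by auto
  show "continuous_on I \<kappa>"
  proof (rule continuous_at_imp_continuous_on, rule ballI)
    fix r assume "r \<in> I"
    define j :: "real \<Rightarrow> real^2" where "j s = axis 2 s" for s
    have j: "vector [0, s] = j s" for s
      by (simp add: j_def vec_eq_iff forall_2 axis_def)
    have "bounded_linear j"
      unfolding j_def by (rule linear_conv_bounded_linear[THEN iffD1], rule linearI)
        (simp_all add: vec_eq_iff axis_def)
    then have "isCont j r"
      by (rule bounded_linear.isCont) simp
    have "j r $ 2 \<in> I"
      using \<open>r \<in> I\<close> by (simp add: j_def axis_def)
    from local[OF this] have "isCont (coord_curvature G) (j r)"
      using continuous_on_eq_continuous_at by blast
    from isCont_o2[OF \<open>isCont j r\<close> this] show "isCont \<kappa> r"
      by (simp add: \<kappa>_def[abs_def] j)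
  qed
qed

text \<open>The band consists of the parallels over the preimage of \<open>[-B, B]\<close> under the
  curvature profile, relatively closed by continuity. The point \<open>p\<close> supplies
  nonemptiness.\<close>

lemma surface_of_revolution_band:
  assumes M: "oriented_riemannian_surface M" "is_curvature M K"
    and X: "surface_of_revolution M X I A"
    and p: "p \<in> topspace (stop M)" "\<bar>K p\<bar> \<le> B"
  shows "band_of_parallels X I {p \<in> topspace (stop M). \<bar>K p\<bar> \<le> B}"
proof -
  obtain \<kappa> where cont: "continuous_on I \<kappa>" and \<kappa>: "\<And>u. u $ 2 \<in> I \<Longrightarrow> K (X u) = \<kappa> (u $ 2)"
    using curvature_surface_of_revolution[OF M X] by blast
  have im: "topspace (stop M) = X ` {u. u $ 2 \<in> I}"
    using X by (simp add: surface_of_revolution_def)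
  let ?S = "I \<inter> \<kappa> -` {- B..B}"
  have "closedin (top_of_set I) ?S"
    by (rule continuous_closedin_preimage[OF cont closed_atLeastAtMost])
  moreover have "?S \<noteq> {}"
    using p \<kappa> unfolding im by (fastforce simp: abs_le_iff)
  moreover have "{p \<in> topspace (stop M). \<bar>K p\<bar> \<le> B} = (\<Union>r\<in>?S. parallel_curve X r)"
    using \<kappa> unfolding im parallel_curve_def by (fastforce simp: abs_le_iff)
  ultimately show ?thesis
    unfolding band_of_parallels_def by blast
qed

text \<open>The radicand is the conserved energy at \<open>t\<^sub>0\<close> divided by
  \<open>C\<^sup>2\<close>.\<close>

theorem corollary4p5p2:
  fixes M :: "'a surface" and K :: "'a \<Rightarrow> real" and C :: real
    and a b :: ereal and \<gamma> :: "real \<Rightarrow> 'a" and t\<^sub>0 :: real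
  assumes "oriented_riemannian_surface M"
    and "is_curvature M K"
    and "C \<noteq> 0"
    and "solution_curve M K C (einterval a b) \<gamma>"
    and "t\<^sub>0 \<in> einterval a b"
  shows "let \<Omega> = {p \<in> topspace (stop M).
                    \<bar>K p\<bar> \<le> sqrt (1 / C\<^sup>2 * (speed M \<gamma> t\<^sub>0)\<^sup>2 + (K (\<gamma> t\<^sub>0))\<^sup>2)}
         in (\<forall>t \<in> einterval a b. \<gamma> t \<in> \<Omega>) \<and>
            (\<forall>X I A. surface_of_revolution M X I A \<longrightarrow> band_of_parallels X I \<Omega>)"
proof -
  define B where "B = sqrt (1 / C\<^sup>2 * (speed M \<gamma> t\<^sub>0)\<^sup>2 + (K (\<gamma> t\<^sub>0))\<^sup>2)"
  have "continuous_map (top_of_set (einterval a b)) (stop M) \<gamma>"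
    using assms(4) by (simp add: solution_curve_def twice_differentiable_curve_def)
  then have top: "\<gamma> t \<in> topspace (stop M)" if "t \<in> einterval a b" for t
    using that by (auto simp: continuous_map_def)
  have bound: "\<bar>K (\<gamma> t)\<bar> \<le> B" if "t \<in> einterval a b" for t
  proof -
    \<comment> \<open>Energy conservation, with the nonnegative squared speed at \<open>t\<close>
      dropped.\<close>
    have "C\<^sup>2 * (K (\<gamma> t))\<^sup>2 \<le> (speed M \<gamma> t\<^sub>0)\<^sup>2 + C\<^sup>2 * (K (\<gamma> t\<^sub>0))\<^sup>2"
      using solution_energy_constant[OF assms(1,2,4) open_einterval convex_einterval that assms(5)]
        zero_le_power2[of "speed M \<gamma> t"] by linarith
    then have "(K (\<gamma> t))\<^sup>2 \<le> 1 / C\<^sup>2 * (speed M \<gamma> t\<^sub>0)\<^sup>2 + (K (\<gamma> t\<^sub>0))\<^sup>2"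
      using assms(3) by (simp add: field_simps)
    then show ?thesis
      unfolding B_def by (rule real_le_rsqrt[of "\<bar>K (\<gamma> t)\<bar>", simplified])
  qed
  \<comment> \<open>The curve point at \<open>t\<^sub>0\<close> lies in the region and so makes the
    band nonempty.\<close>
  show ?thesis
    unfolding Let_def B_def[symmetric]
    using top bound assms(5) surface_of_revolution_band[OF assms(1,2) _ top bound] by blast
qed

end
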